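(* Let $X$ be a complex Banach space which has a (Schauder) basis that is both subsymmetric and shrinking. Then $X$ has property $(\mathbb{A})$.
   Context: A basis $(x_n)_{n\in\mathbb{N}}$ of $X$ is subsymmetric if it is unconditional and is equivalent to the basic sequence $(x_{n_i})_{i\in\mathbb{N}}$ for every increasing sequence $(n_i)_{i\in\mathbb{N}}$ of positive integers. It is shrinking if its coordinate functionals span a norm dense subspace of $X^*$ (equivalently, form a basis of $X^*$). $\mathcal{F}(X)$ is the operator-norm closure of the finite rank operators on $X$. An irreducible $(n\times n)$-matrix group is a finite subgroup of $GL_n(\mathbb{C})$ whose linear span is all of $M_n(\mathbb{C})$. For a finite biorthogonal system $\{(x_i,x_j^* ) : x_i\in X,\ x_j^*\in X^*,\ i,j=1,\dots,n\}$ (i.e. $x_j^*(x_i)=\delta_{ij}$), the associated algebra homomorphism $E:M_n(\mathbb{C})\to\mathcal{F}(X)$ is $E((a_{ij}))=\sum_{i,j}a_{ij}\,x_i\otimes x_j^*$, where $x\otimes x^*$ is the operator $z\mapsto x^*(z)x$. Property $(\mathbb{A})$ for $X$: there is a net of finite biorthogonal systems $\{(x_{i,\lambda},x_{j,\lambda}^* ) : i,j=1,\dots,n_\lambda\}$ $(\lambda\in\Lambda)$ in $X\times X^*$, with corresponding maps $E_\lambda:M_{n_\lambda}(\mathbb{C})\to\mathcal{F}(X)$, such that with $P_\lambda=E_\lambda(I_{n_\lambda})$: (i) $P_\lambda\to 1_X$ strongly; (ii) the adjoints $P_\lambda^a\to 1_{X^*}$ strongly; (iii) for each $\lambda$ there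 is an irreducible $(n_\lambda\times n_\lambda)$-matrix group $\mathcal{G}_\lambda$ such that $\sup\{\|E_\lambda(g)\| : g\in\mathcal{G}_\lambda,\ \lambda\in\Lambda\}<\infty$ (operator norm). *)

theory Defs
  imports "HOL-Analysis.Analysis" "Jordan_Normal_Form.Matrix"
begin

section \<open>Complex normed spaces\<close>

text \<open>
  A complex normed space is a real normed space together with a compatible complex scalar
  multiplication.  Sums, limits and norms are those of the underlying real space.
\<close>

class complex_normed_vector = real_normed_vector +
  fixes scaleC :: "complex \<Rightarrow> 'a \<Rightarrow> 'a"  (infixr "*\<^sub>C" 75)
  assumes scaleC_add_right: "c *\<^sub>C (x + y) = c *\<^sub>C x + c *\<^sub>C y"
    and scaleC_add_left: "(c + d) *\<^sub>C x = c *\<^sub>C x + d *\<^sub>C x"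
    and scaleC_scaleC: "c *\<^sub>C d *\<^sub>C x = (c * d) *\<^sub>C x"
    and scaleC_of_real: "complex_of_real r *\<^sub>C x = r *\<^sub>R x"
    and norm_scaleC: "norm (c *\<^sub>C x) = cmod c * norm x"

class complex_banach = complex_normed_vector + banach

instantiation complex :: complex_banach
begin
definition scaleC_complex_def [simp]: "c *\<^sub>C (z :: complex) = c * z"
instance by standard (auto simp: algebra_simps norm_mult scaleR_conv_of_real)
end

lemma scaleC_one: "1 *\<^sub>C (x :: 'a::complex_normed_vector) = x"
  using scaleC_of_real[of 1 x] by simp

lemma vector_space_scaleC: "vector_space (scaleC :: complex \<Rightarrow> 'a \<Rightarrow> 'a::complex_normed_vector)"
  by unfold_locales
    (auto simp: scaleC_add_right scaleC_add_left scaleC_scaleC scaleC_one)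

abbreviation cspan :: "'a::complex_normed_vector set \<Rightarrow> 'a set"
  where "cspan \<equiv> Modules.module.span scaleC"

lemma bounded_linear_scaleC_right: "bounded_linear (scaleC c :: 'a \<Rightarrow> 'a::complex_normed_vector)"
proof (rule bounded_linear_intro[where K = "cmod c"])
  show "c *\<^sub>C (r *\<^sub>R x) = r *\<^sub>R c *\<^sub>C x" for r and x :: 'a
    by (simp flip: scaleC_of_real add: scaleC_scaleC mult.commute)
qed (auto simp: scaleC_add_right norm_scaleC mult.commute)

instantiation blinfun :: (real_normed_vector, complex_normed_vector) complex_normed_vector
begin

lift_definition scaleC_blinfun :: "complex \<Rightarrow> 'a \<Rightarrow>\<^sub>L 'b \<Rightarrow> 'a \<Rightarrow>\<^sub>L 'b"
  is "\<lambda>c f z. c *\<^sub>C f z"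
  by (rule bounded_linear_compose[OF bounded_linear_scaleC_right])

instance
proof
  fix c d :: complex and f g :: "'a \<Rightarrow>\<^sub>L 'b" and r :: real
  show "c *\<^sub>C (f + g) = c *\<^sub>C f + c *\<^sub>C g"
    by transfer (simp add: scaleC_add_right fun_eq_iff)
  show "(c + d) *\<^sub>C f = c *\<^sub>C f + d *\<^sub>C f"
    by transfer (simp add: scaleC_add_left fun_eq_iff)
  show assoc: "c *\<^sub>C d *\<^sub>C f = (c * d) *\<^sub>C f" for c d and f :: "'a \<Rightarrow>\<^sub>L 'b"
    by transfer (simp add: scaleC_scaleC fun_eq_iff)
  show real: "complex_of_real r *\<^sub>C f = r *\<^sub>R f" for r and f :: "'a \<Rightarrow>\<^sub>L 'b"
    by transfer (simp add: scaleC_of_real fun_eq_iff)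
  have le: "norm (c *\<^sub>C f) \<le> cmod c * norm f" for c and f :: "'a \<Rightarrow>\<^sub>L 'b"
  proof (rule norm_blinfun_bound)
    show "norm (blinfun_apply (c *\<^sub>C f) z) \<le> cmod c * norm f * norm z" for z
      using mult_left_mono[OF norm_blinfun[of f z], of "cmod c"]
      by (simp add: scaleC_blinfun.rep_eq norm_scaleC mult.assoc)
  qed simp
  show "norm (c *\<^sub>C f) = cmod c * norm f"
  proof (cases "c = 0")
    case True
    then show ?thesis using le[of 0 f] by simp
  next
    case False
    have "f = inverse c *\<^sub>C c *\<^sub>C f"
      using False real[of 1 f] by (simp add: assoc)
    then have "norm f \<le> cmod (inverse c) * norm (c *\<^sub>C f)"
      using le[of "inverse c" "c *\<^sub>C f"] by simp
    then have "cmod c * norm f \<le> norm (c *\<^sub>C f)"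
      using False by (simp add: norm_divide field_simps)
    with le[of c f] show ?thesis by simp
  qed
qed

end

text \<open>
  The type \<open>'a \<Rightarrow>\<^sub>L complex\<close> contains all bounded real-linear maps; the dual \<open>X\<^sup>*\<close> of the
  complex space consists of the complex-linear ones among them.
\<close>

definition cdual :: "('a::complex_normed_vector \<Rightarrow>\<^sub>L complex) set"
  where "cdual = {f. \<forall>c z. blinfun_apply f (c *\<^sub>C z) = c * blinfun_apply f z}"


section \<open>Bases\<close>

definition schauder_basis :: "(nat \<Rightarrow> 'a::complex_banach) \<Rightarrow> bool"
  where "schauder_basis x \<longleftrightarrow> (\<forall>z. \<exists>!a. (\<lambda>n. a n *\<^sub>C x n) sums z)"

definition basis_coord :: "(nat \<Rightarrow> 'a::complex_banach) \<Rightarrow> nat \<Rightarrow> 'a \<Rightarrow> complex"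
  where "basis_coord x n z = (THE a. (\<lambda>n. a n *\<^sub>C x n) sums z) n"

text \<open>A basis is unconditional if all rearrangements of all basis expansions converge.\<close>

definition unconditional_basis :: "(nat \<Rightarrow> 'a::complex_banach) \<Rightarrow> bool"
  where "unconditional_basis x \<longleftrightarrow> schauder_basis x \<and>
    (\<forall>z \<pi>. bij \<pi> \<longrightarrow> summable (\<lambda>n. basis_coord x (\<pi> n) z *\<^sub>C x (\<pi> n)))"

definition equivalent_sequences ::
    "(nat \<Rightarrow> 'a::complex_banach) \<Rightarrow> (nat \<Rightarrow> 'b::complex_banach) \<Rightarrow> bool"
  where "equivalent_sequences x y \<longleftrightarrow>
    (\<forall>a. summable (\<lambda>n. a n *\<^sub>C x n) \<longleftrightarrow> summable (\<lambda>n. a n *\<^sub>C y n))"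

definition subsymmetric_basis :: "(nat \<Rightarrow> 'a::complex_banach) \<Rightarrow> bool"
  where "subsymmetric_basis x \<longleftrightarrow> unconditional_basis x \<and>
    (\<forall>s. strict_mono s \<longrightarrow> equivalent_sequences x (x \<circ> s))"

text \<open>Here \<open>f n\<close> is the \<open>n\<close>-th coordinate functional, as an element of \<open>X\<^sup>*\<close>.\<close>

definition shrinking_basis :: "(nat \<Rightarrow> 'a::complex_banach) \<Rightarrow> bool"
  where "shrinking_basis x \<longleftrightarrow> schauder_basis x \<and>
    (\<exists>f :: nat \<Rightarrow> 'a \<Rightarrow>\<^sub>L complex.
       (\<forall>n. f n \<in> cdual \<and> blinfun_apply (f n) = basis_coord x n) \<and>
       closure (cspan (range f)) = cdual)"


section \<open>Biorthogonal systems and matrix groups\<close>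

text \<open>
  The \<open>n\<close> vectors of a finite system are the values at the indices \<open>i < n\<close>;
  values at other indices are irrelevant.
\<close>

definition biorthogonal_system ::
    "nat \<Rightarrow> (nat \<Rightarrow> 'a::complex_banach) \<Rightarrow> (nat \<Rightarrow> 'a \<Rightarrow>\<^sub>L complex) \<Rightarrow> bool"
  where "biorthogonal_system n x f \<longleftrightarrow> 0 < n \<and> (\<forall>j<n. f j \<in> cdual) \<and>
    (\<forall>i<n. \<forall>j<n. blinfun_apply (f j) (x i) = (if i = j then 1 else 0))"

lift_definition rank_one :: "'a::complex_banach \<Rightarrow> ('a \<Rightarrow>\<^sub>L complex) \<Rightarrow> 'a \<Rightarrow>\<^sub>L 'a"
  is "\<lambda>x f z. f z *\<^sub>C x"
proof -
  fix x :: 'a and f :: "'a \<Rightarrow> complex"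
  assume "bounded_linear f"
  moreover have "bounded_linear (\<lambda>c. c *\<^sub>C x)"
    by (rule bounded_linear_intro[where K = "norm x"])
      (auto simp: scaleC_add_left norm_scaleC scaleR_conv_of_real
            simp flip: scaleC_scaleC scaleC_of_real)
  ultimately show "bounded_linear (\<lambda>z. f z *\<^sub>C x)"
    using bounded_linear_compose by blast
qed

definition matrix_operator ::
    "nat \<Rightarrow> (nat \<Rightarrow> 'a::complex_banach) \<Rightarrow> (nat \<Rightarrow> 'a \<Rightarrow>\<^sub>L complex) \<Rightarrow> complex mat \<Rightarrow> 'a \<Rightarrow>\<^sub>L 'a"
  where "matrix_operator n x f A = (\<Sum>i<n. \<Sum>j<n. A $$ (i, j) *\<^sub>C rank_one (x i) (f j))"

text \<open>\<open>units_of (ring_mat TYPE(complex) n ())\<close> is the group \<open>GL\<^sub>n(\<complex>)\<close>.\<close>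

definition irreducible_matrix_group :: "nat \<Rightarrow> complex mat set \<Rightarrow> bool"
  where "irreducible_matrix_group n G \<longleftrightarrow>
    finite G \<and> subgroup G (units_of (ring_mat TYPE(complex) n ())) \<and>
    (\<forall>A \<in> carrier_mat n n. \<exists>c :: complex mat \<Rightarrow> complex.
       A = mat n n (\<lambda>(i, j). \<Sum>g\<in>G. c g * g $$ (i, j)))"


section \<open>Property A\<close>

definition directed_set :: "'l set \<Rightarrow> ('l \<Rightarrow> 'l \<Rightarrow> bool) \<Rightarrow> bool"
  where "directed_set \<Lambda> leq \<longleftrightarrow> \<Lambda> \<noteq> {} \<and> (\<forall>a\<in>\<Lambda>. leq a a) \<and>
    (\<forall>a\<in>\<Lambda>. \<forall>b\<in>\<Lambda>. \<forall>c\<in>\<Lambda>. leq a b \<longrightarrow> leq b c \<longrightarrow> leq a c) \<and>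
    (\<forall>a\<in>\<Lambda>. \<forall>b\<in>\<Lambda>. \<exists>c\<in>\<Lambda>. leq a c \<and> leq b c)"

text \<open>The filter of tails: \<open>(f \<longlongrightarrow> y) (net_filter \<Lambda> leq)\<close> is convergence of the net \<open>f\<close> to \<open>y\<close>.\<close>

definition net_filter :: "'l set \<Rightarrow> ('l \<Rightarrow> 'l \<Rightarrow> bool) \<Rightarrow> 'l filter"
  where "net_filter \<Lambda> leq = (INF a\<in>\<Lambda>. principal {b\<in>\<Lambda>. leq a b})"

definition property_A_witness ::
    "'l set \<Rightarrow> ('l \<Rightarrow> 'l \<Rightarrow> bool) \<Rightarrow> ('l \<Rightarrow> nat) \<Rightarrow> ('l \<Rightarrow> nat \<Rightarrow> 'a::complex_banach) \<Rightarrow>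
     ('l \<Rightarrow> nat \<Rightarrow> 'a \<Rightarrow>\<^sub>L complex) \<Rightarrow> bool"
  where "property_A_witness \<Lambda> leq n x f \<longleftrightarrow>
    directed_set \<Lambda> leq \<and>
    (\<forall>l\<in>\<Lambda>. biorthogonal_system (n l) (x l) (f l)) \<and>
    (let E = (\<lambda>l. matrix_operator (n l) (x l) (f l)); P = (\<lambda>l. E l (1\<^sub>m (n l))) in
      (\<forall>z. ((\<lambda>l. blinfun_apply (P l) z) \<longlongrightarrow> z) (net_filter \<Lambda> leq)) \<and>
      (\<forall>\<phi>\<in>cdual. ((\<lambda>l. \<phi> o\<^sub>L P l) \<longlongrightarrow> \<phi>) (net_filter \<Lambda> leq)) \<and>
      (\<exists>G. (\<forall>l\<in>\<Lambda>. irreducible_matrix_group (n l) (G l)) \<and>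
           bdd_above {norm (E l g) | l g. l \<in> \<Lambda> \<and> g \<in> G l}))"

text \<open>
  A definition cannot quantify over the type of the index set of a net, so that type is fixed to
  one in which every net of biorthogonal systems as required can be reindexed, see
  \<open>property_A_if_witness\<close> below: the index set may be any subset, with any directed preorder.
\<close>

type_synonym 'a net_index = "'a set \<times> ('a \<Rightarrow>\<^sub>L complex) set \<times> nat"

definition property_A :: "'a::complex_banach itself \<Rightarrow> bool"
  where "property_A (_ :: 'a itself) \<longleftrightarrow>
    (\<exists>(\<Lambda> :: 'a net_index set) leq n (x :: _ \<Rightarrow> nat \<Rightarrow> 'a) f. property_A_witness \<Lambda> leq n x f)"

lemma eventually_net_filter:
  assumes "directed_set \<Lambda> leq"
  shows "eventually P (net_filter \<Lambda> leq) \<longleftrightarrow> (\<exists>a\<in>\<Lambda>. \<forall>b\<in>\<Lambda>. leq a b \<longrightarrow> P b)"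
proof -
  have "eventually P (net_filter \<Lambda> leq) \<longleftrightarrow> (\<exists>a\<in>\<Lambda>. eventually P (principal {b\<in>\<Lambda>. leq a b}))"
    unfolding net_filter_def
  proof (rule eventually_INF_base)
    show "\<Lambda> \<noteq> {}" using assms by (simp add: directed_set_def)
    fix a b assume ab: "a \<in> \<Lambda>" "b \<in> \<Lambda>"
    then obtain c where c: "c \<in> \<Lambda>" "leq a c" "leq b c"
      using assms unfolding directed_set_def by blast
    then have "{d\<in>\<Lambda>. leq c d} \<subseteq> {d\<in>\<Lambda>. leq a d} \<inter> {d\<in>\<Lambda>. leq b d}"
      using ab assms unfolding directed_set_def by blast
    with c(1) show "\<exists>c\<in>\<Lambda>. principal {d\<in>\<Lambda>. leq c d} \<le>
        inf (principal {d\<in>\<Lambda>. leq a d}) (principal {d\<in>\<Lambda>. leq b d})"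
      by auto
  qed
  then show ?thesis by (auto simp: eventually_principal)
qed

lemma property_A_if_witness:
  fixes \<Lambda> :: "'l set" and x :: "'l \<Rightarrow> nat \<Rightarrow> 'a::complex_banach"
  assumes "property_A_witness \<Lambda> leq n x f"
  shows "property_A TYPE('a)"
proof -
  define E where "E = (\<lambda>l. matrix_operator (n l) (x l) (f l))"
  define P where "P = (\<lambda>l. E l (1\<^sub>m (n l)))"
  obtain G where dir: "directed_set \<Lambda> leq"
    and bio: "\<forall>l\<in>\<Lambda>. biorthogonal_system (n l) (x l) (f l)"
    and lim: "\<And>z. ((\<lambda>l. blinfun_apply (P l) z) \<longlongrightarrow> z) (net_filter \<Lambda> leq)"
    and dlim: "\<And>\<phi>. \<phi> \<in> cdual \<Longrightarrow> ((\<lambda>l. \<phi> o\<^sub>L P l) \<longlongrightarrow> \<phi>) (net_filter \<Lambda> leq)"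
    and irr: "\<forall>l\<in>\<Lambda>. irreducible_matrix_group (n l) (G l)"
    and bdd: "bdd_above {norm (E l g) | l g. l \<in> \<Lambda> \<and> g \<in> G l}"
    using assms unfolding property_A_witness_def Let_def E_def P_def by blast
  define M :: "'a net_index set" where "M = {(S, T, m). finite S \<and> finite T \<and> T \<subseteq> cdual}"
  define leM :: "'a net_index \<Rightarrow> 'a net_index \<Rightarrow> bool" where
    "leM = (\<lambda>(S, T, m) (S', T', m'). S \<subseteq> S' \<and> T \<subseteq> T' \<and> m \<le> m')"
  define good :: "'a net_index \<Rightarrow> 'l \<Rightarrow> bool" where
    "good = (\<lambda>(S, T, m) l. (\<forall>z\<in>S. dist (blinfun_apply (P l) z) z < 1 / real (Suc m)) \<and>
      (\<forall>\<phi>\<in>T. dist (\<phi> o\<^sub>L P l) \<phi> < 1 / real (Suc m)))"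
  have "\<exists>l\<in>\<Lambda>. good \<mu> l" if mu: "\<mu> \<in> M" for \<mu>
  proof -
    obtain S T m where m: "\<mu> = (S, T, m)" "finite S" "finite T" "T \<subseteq> cdual"
      using mu unfolding M_def by auto
    have "eventually (\<lambda>l. \<forall>z\<in>S. dist (blinfun_apply (P l) z) z < 1 / real (Suc m)) (net_filter \<Lambda> leq)"
      by (rule eventually_ball_finite[OF m(2)]) (use tendstoD[OF lim] in simp)
    moreover have "eventually (\<lambda>l. \<forall>\<phi>\<in>T. dist (\<phi> o\<^sub>L P l) \<phi> < 1 / real (Suc m)) (net_filter \<Lambda> leq)"
      by (rule eventually_ball_finite[OF m(3)]) (use tendstoD[OF dlim] m(4) in auto)
    ultimately have "eventually (good \<mu>) (net_filter \<Lambda> leq)"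
      unfolding good_def m(1) by (simp add: eventually_conj)
    then show ?thesis
      unfolding eventually_net_filter[OF dir] using dir unfolding directed_set_def by blast
  qed
  then obtain h where h: "\<And>\<mu>. \<mu> \<in> M \<Longrightarrow> h \<mu> \<in> \<Lambda>" "\<And>\<mu>. \<mu> \<in> M \<Longrightarrow> good \<mu> (h \<mu>)"
    by metis
  have dirM: "directed_set M leM"
    unfolding directed_set_def
  proof (intro conjI ballI)
    show "M \<noteq> {}" unfolding M_def by auto
    show "\<exists>c\<in>M. leM a c \<and> leM b c" if "a \<in> M" "b \<in> M" for a b
    proof (rule bexI)
      let ?c = "(fst a \<union> fst b, fst (snd a) \<union> fst (snd b), max (snd (snd a)) (snd (snd b)))"
      show "leM a ?c \<and> leM b ?c" unfolding leM_def by (auto split: prod.splits)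
      show "?c \<in> M" using that unfolding M_def by auto
    qed
  qed (auto simp: leM_def split: prod.splits)
  have small: "\<exists>N. \<forall>m\<ge>N. 1 / real (Suc m) < e" if e: "e > 0" for e :: real
  proof -
    obtain N where N: "1 / real (Suc N) < e" using nat_approx_posE[OF e] by blast
    have "1 / real (Suc m) \<le> 1 / real (Suc N)" if "m \<ge> N" for m
      using that by (intro divide_left_mono) auto
    with N show ?thesis by (meson le_less_trans)
  qed
  have limM: "((\<lambda>\<mu>. blinfun_apply (P (h \<mu>)) z) \<longlongrightarrow> z) (net_filter M leM)" for z
  proof (rule tendstoI)
    fix e :: real assume "e > 0"
    then obtain N where N: "\<And>m. m \<ge> N \<Longrightarrow> 1 / real (Suc m) < e" using small by blast
    have "({z}, {}, N) \<in> M" unfolding M_def by auto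
    moreover have "dist (blinfun_apply (P (h b)) z) z < e" if "b \<in> M" "leM ({z}, {}, N) b" for b
      using h(2)[OF that(1)] that(2) N unfolding good_def leM_def
      by (fastforce split: prod.splits intro: less_trans)
    ultimately show "eventually (\<lambda>\<mu>. dist (blinfun_apply (P (h \<mu>)) z) z < e) (net_filter M leM)"
      unfolding eventually_net_filter[OF dirM] by blast
  qed
  have dlimM: "((\<lambda>\<mu>. \<phi> o\<^sub>L P (h \<mu>)) \<longlongrightarrow> \<phi>) (net_filter M leM)" if "\<phi> \<in> cdual" for \<phi>
  proof (rule tendstoI)
    fix e :: real assume "e > 0"
    then obtain N where N: "\<And>m. m \<ge> N \<Longrightarrow> 1 / real (Suc m) < e" using small by blast
    have "({}, {\<phi>}, N) \<in> M" unfolding M_def using that by auto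
    moreover have "dist (\<phi> o\<^sub>L P (h b)) \<phi> < e" if "b \<in> M" "leM ({}, {\<phi>}, N) b" for b
      using h(2)[OF that(1)] that(2) N unfolding good_def leM_def
      by (fastforce split: prod.splits intro: less_trans)
    ultimately show "eventually (\<lambda>\<mu>. dist (\<phi> o\<^sub>L P (h \<mu>)) \<phi> < e) (net_filter M leM)"
      unfolding eventually_net_filter[OF dirM] by blast
  qed
  have bddM: "bdd_above {norm (E (h \<mu>) g) | \<mu> g. \<mu> \<in> M \<and> g \<in> G (h \<mu>)}"
    by (rule bdd_above_mono[OF bdd]) (use h(1) in blast)
  have "property_A_witness M leM (n \<circ> h) (x \<circ> h) (f \<circ> h)"
    unfolding property_A_witness_def Let_def
    by (intro conjI exI[of _ "G \<circ> h"])
      (use dirM bio irr h(1) limM dlimM bddM in \<open>auto simp: E_def P_def\<close>)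
  then show ?thesis unfolding property_A_def by blast
qed

end

theory Submission
  imports Defs
begin

text \<open>
  The systems are the initial segments \<open>x\<^sub>0, \<dots>, x\<^sub>l\<close> of the basis together with their
  coordinate functionals, and the matrix groups consist of the signed cyclic shifts: the
  monomial matrices with entries \<open>\<plusminus>1\<close> whose underlying permutation is a power of an
  \<open>n\<close>-cycle.  The full group of signed permutation matrices would not do, because a subsymmetric
  basis need not be symmetric, so that arbitrary permutations of the basis need not act boundedly.
  A cyclic shift, however, is increasing on the indices that do not wrap around and increasing on
  those that do.  Splitting further according to the sign, each signed cyclic shift is the sum of
  four operators which, up to the sign, move the coordinates in a finite set \<open>A\<close> along a strictly
  increasing map \<open>\<sigma>\<close>,
  \<open>z \<mapsto> \<Sum>i\<in>A. f\<^sub>i(z) x\<^bsub>\<sigma>(i)\<^esub>\<close>.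

  What has to be shown is that these relocations are bounded uniformly in \<open>A\<close> and \<open>\<sigma>\<close>
  (\<open>relocation_uniformly_bounded\<close>).  By the uniform boundedness principle it suffices to bound
  them at each \<open>z\<close>.  If they were unbounded at \<open>z\<close>, then, since finitely many coordinates and
  finitely many target positions contribute a bounded amount, there would be a sequence of
  relocations, with pieces and images lying in consecutive blocks of integers, whose values at
  \<open>z\<close> have norm at least 1.  They fit together to one increasing map.
  Unconditionality allows to restrict the expansion of \<open>z\<close> to the union of the pieces, and
  subsymmetry allows to move the result along that map; the outcome is a convergent expansion
  with infinitely many disjoint blocks of norm at least 1, which is absurd.

  Irreducibility holds because two signed cyclic shifts that differ in a single sign differ by twice
  a matrix unit.  The projections converge strongly by the definition of a basis; their adjoints
  fix each coordinate functional eventually and are uniformly bounded, hence converge strongly on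
  the closed span of the coordinate functionals, which is the whole dual as the basis is shrinking.
\<close>

section \<open>Uniform boundedness\<close>

text \<open>
  The uniform boundedness principle, from Baire's category theorem: the closed sets on which all
  operators are at most \<open>n\<close> cover the space, so one of them contains a ball.
\<close>

lemma uniform_boundedness:
  fixes S :: "('a::banach \<Rightarrow>\<^sub>L 'b::real_normed_vector) set"
  assumes pointwise: "\<And>z. \<exists>K. \<forall>T\<in>S. norm (blinfun_apply T z) \<le> K"
  shows "\<exists>C. \<forall>T\<in>S. norm T \<le> C"
proof -
  define V where "V = (\<lambda>n::nat. {z. \<forall>T\<in>S. norm (blinfun_apply T z) \<le> real n})"
  have V_closed: "closed (V n)" for n
  proof -
    have "V n = (\<Inter>T\<in>S. {z. norm (blinfun_apply T z) \<le> real n})"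
      unfolding V_def by auto
    moreover have "closed {z. norm (blinfun_apply T z) \<le> real n}" for T :: "'a \<Rightarrow>\<^sub>L 'b"
      by (intro closed_Collect_le continuous_intros)
    ultimately show ?thesis by auto
  qed
  have cover: "(\<Union>n. V n) = UNIV"
  proof -
    have "\<exists>n. z \<in> V n" for z
    proof -
      obtain K where K: "\<forall>T\<in>S. norm (blinfun_apply T z) \<le> K" using pointwise by blast
      obtain n where "K \<le> real n" using real_arch_simple by blast
      then show ?thesis using K unfolding V_def by (auto intro: order_trans)
    qed
    then show ?thesis by auto
  qed
  have "\<exists>n. interior (V n) \<noteq> {}"
  proof (rule ccontr)
    assume empty: "\<not> ?thesis"
    have "Met_TC.mcomplete TYPE('a)"
      unfolding Met_TC.mcomplete_def by (auto simp: Cauchy_convergent_iff convergent_def)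
    then have "(Met_TC.mtopology :: 'a topology) interior_of (\<Union>(range V)) = {}"
      by (rule Met_TC.metric_Baire_category_alt)
        (use empty V_closed in auto)
    then show False using cover by simp
  qed
  then obtain n where "interior (V n) \<noteq> {}" by blast
  then obtain z0 r where r: "r > 0" "cball z0 r \<subseteq> V n"
    using mem_interior_cball by blast
  have "norm T \<le> 2 * real n / r" if "T \<in> S" for T
  proof (rule norm_blinfun_bound)
    show "norm (blinfun_apply T z) \<le> 2 * real n / r * norm z" for z
    proof (cases "z = 0")
      case False
      define u where "u = (r / norm z) *\<^sub>R z"
      have "norm u = r" using r(1) False by (simp add: u_def)
      then have "z0 + u \<in> V n" "z0 \<in> V n" using r by (auto simp: dist_norm)
      then have "norm (blinfun_apply T (z0 + u)) \<le> real n" "norm (blinfun_apply T z0) \<le> real n"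
        using that unfolding V_def by auto
      moreover have "norm (blinfun_apply T u)
          \<le> norm (blinfun_apply T (z0 + u)) + norm (blinfun_apply T z0)"
        using norm_triangle_ineq4[of "blinfun_apply T (z0 + u)" "blinfun_apply T z0"]
        by (simp add: blinfun.add_right)
      ultimately have "norm (blinfun_apply T u) \<le> 2 * real n" by linarith
      then show ?thesis using r(1) False
        by (simp add: u_def blinfun.scaleR_right field_simps)
    qed simp
  qed (use r in simp)
  then show ?thesis by blast
qed

section \<open>Unconditional convergence\<close>

text \<open>
  Serves to assemble a map on the natural numbers from maps on consecutive blocks: \<open>K n\<close> tells
  which of them applies at \<open>n\<close>.
\<close>

lemma strict_mono_block_ex:
  fixes M :: "nat \<Rightarrow> nat"
  assumes "strict_mono M" "M 0 = 0"
  obtains K where "\<And>n. M (K n) \<le> n \<and> n < M (Suc (K n))"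
    and "\<And>n k. M k \<le> n \<Longrightarrow> n < M (Suc k) \<Longrightarrow> K n = k"
proof -
  have "\<exists>k. M k \<le> n \<and> n < M (Suc k)" for n
  proof (induction n)
    case 0
    then show ?case using assms by (metis le_refl strict_monoD lessI)
  next
    case (Suc n)
    then obtain k where k: "M k \<le> n" "n < M (Suc k)" by blast
    show ?case
    proof (cases "Suc n < M (Suc k)")
      case True
      then show ?thesis using k by (intro exI[of _ k]) simp
    next
      case False
      then have "M (Suc k) = Suc n" using k by simp
      moreover have "M (Suc k) < M (Suc (Suc k))" using assms by (simp add: strict_mono_less)
      ultimately show ?thesis by (intro exI[of _ "Suc k"]) simp
    qed
  qed
  then obtain K where K: "\<And>n. M (K n) \<le> n \<and> n < M (Suc (K n))" by metis
  have uniq: "K n = k" if "M k \<le> n" "n < M (Suc k)" for n k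
  proof -
    have "M k < M (Suc (K n))" "M (K n) < M (Suc k)" using K[of n] that by auto
    then have "k < Suc (K n)" "K n < Suc k" using assms(1) strict_mono_less by blast+
    then show ?thesis by simp
  qed
  from K uniq show ?thesis by (rule that)
qed

text \<open>
  If the conclusion fails, then finite sets \<open>F k\<close> with sums of norm at least \<open>e\<close> can be
  found in consecutive intervals.  The permutation that lists, inside each interval, the elements
  of \<open>F k\<close> first turns these sums into sums over consecutive terms, which contradicts
  Cauchy's criterion for the rearranged series.
\<close>

lemma rearrangements_summable_imp_Cauchy:
  fixes y :: "nat \<Rightarrow> 'a::banach"
  assumes rearr: "\<And>\<pi>. bij \<pi> \<Longrightarrow> summable (\<lambda>n. y (\<pi> n))" and e: "e > 0"
  shows "\<exists>N. \<forall>F. finite F \<longrightarrow> F \<subseteq> {N..} \<longrightarrow> norm (sum y F) < e"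
proof (rule ccontr)
  assume "\<not> ?thesis"
  then have "\<forall>N. \<exists>F. finite F \<and> F \<subseteq> {N..} \<and> norm (sum y F) \<ge> e" by (meson not_le)
  then obtain H where H: "\<And>N. finite (H N)" "\<And>N. H N \<subseteq> {N..}" "\<And>N. norm (sum y (H N)) \<ge> e"
    by metis
  have H_ne: "H N \<noteq> {}" for N using H(3)[of N] e by auto
  define M where "M = rec_nat 0 (\<lambda>_ N. Suc (Max (H N)))"
  define F where "F k = H (M k)" for k
  have M0: "M 0 = 0" and MS: "M (Suc k) = Suc (Max (F k))" for k by (auto simp: M_def F_def)
  have F_fin: "finite (F k)" and F_e: "norm (sum y (F k)) \<ge> e" for k
    using H by (auto simp: F_def)
  have F_sub: "F k \<subseteq> {M k..<M (Suc k)}" for k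
    using H(2)[of "M k"] Max_ge[OF F_fin[of k]] unfolding MS F_def by (auto simp: less_Suc_eq_le)
  have "F k \<noteq> {}" for k using H_ne by (simp add: F_def)
  then have "M k < M (Suc k)" for k using F_sub[of k] by fastforce
  then have M_mono: "strict_mono M" by (simp add: strict_mono_Suc_iff)
  obtain K where K: "\<And>n. M (K n) \<le> n \<and> n < M (Suc (K n))"
    and K_eq: "\<And>n k. M k \<le> n \<Longrightarrow> n < M (Suc k) \<Longrightarrow> K n = k"
    using strict_mono_block_ex[OF M_mono M0] by blast
  have "\<exists>h. bij_betw h {M k..<M (Suc k)} {M k..<M (Suc k)} \<and>
      bij_betw h {M k..<M k + card (F k)} (F k)" for k
  proof -
    let ?I = "{M k..<M (Suc k)}" and ?J = "{M k..<M k + card (F k)}"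
    have "card (F k) \<le> card ?I" by (intro card_mono F_sub) simp
    then have J: "?J \<subseteq> ?I" by (cases "M k \<le> M (Suc k)") auto
    obtain h1 where h1: "bij_betw h1 ?J (F k)"
      using finite_same_card_bij[of ?J "F k"] F_fin by auto
    have "card (?I - ?J) = card (?I - F k)"
      using J F_sub[of k] F_fin[of k] by (simp add: card_Diff_subset)
    then obtain h2 where h2: "bij_betw h2 (?I - ?J) (?I - F k)"
      using finite_same_card_bij[of "?I - ?J" "?I - F k"] by auto
    define h where "h n = (if n \<in> ?J then h1 n else h2 n)" for n
    have a: "bij_betw h ?J (F k)" using h1 bij_betw_cong[of ?J h h1] by (simp add: h_def)
    have "bij_betw h (?I - ?J) (?I - F k)"
      using h2 bij_betw_cong[of "?I - ?J" h h2] by (simp add: h_def)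
    with a have "bij_betw h (?J \<union> (?I - ?J)) (F k \<union> (?I - F k))"
      by (rule bij_betw_combine) auto
    moreover have "?J \<union> (?I - ?J) = ?I" "F k \<union> (?I - F k) = ?I" using J F_sub[of k] by auto
    ultimately show ?thesis using a by auto
  qed
  then obtain h where h: "\<And>k. bij_betw (h k) {M k..<M (Suc k)} {M k..<M (Suc k)}"
    "\<And>k. bij_betw (h k) {M k..<M k + card (F k)} (F k)"
    by metis
  define \<pi> where "\<pi> n = h (K n) n" for n
  have \<pi>_block: "\<pi> n \<in> {M (K n)..<M (Suc (K n))}" for n
    using bij_betwE[OF h(1)[of "K n"]] K[of n] by (auto simp: \<pi>_def)
  then have K\<pi>: "K (\<pi> n) = K n" for n using K_eq by simp
  have "bij \<pi>"
    unfolding bij_def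
  proof
    show "inj \<pi>"
    proof (rule injI)
      fix a b assume ab: "\<pi> a = \<pi> b"
      then have "K a = K b" using K\<pi> by metis
      then show "a = b" using ab K[of a] K[of b] h(1)[of "K a"]
        unfolding \<pi>_def bij_betw_def inj_on_def by auto
    qed
    have "\<exists>n. \<pi> n = m" for m
    proof -
      have "m \<in> h (K m) ` {M (K m)..<M (Suc (K m))}"
        using h(1)[of "K m"] K[of m] by (simp add: bij_betw_def)
      then obtain n where "n \<in> {M (K m)..<M (Suc (K m))}" "m = h (K m) n" by blast
      then show ?thesis using K_eq[of "K m" n] by (intro exI[of _ n]) (simp add: \<pi>_def)
    qed
    then show "surj \<pi>" by (metis surjI)
  qed
  then have "summable (\<lambda>n. y (\<pi> n))" by (rule rearr)
  then obtain N where N: "\<And>m n. m \<ge> N \<Longrightarrow> norm (\<Sum>i=m..<n. y (\<pi> i)) < e"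
    using e unfolding summable_Cauchy by blast
  have "(\<Sum>i=M N..<M N + card (F N). y (\<pi> i)) = sum y (F N)"
  proof (rule sum.reindex_bij_betw)
    have "card (F N) \<le> card {M N..<M (Suc N)}" by (intro card_mono F_sub) simp
    then have "K i = N" if "i \<in> {M N..<M N + card (F N)}" for i
      using that by (intro K_eq) auto
    then show "bij_betw \<pi> {M N..<M N + card (F N)} (F N)"
      using h(2)[of N] bij_betw_cong[of "{M N..<M N + card (F N)}" \<pi> "h N"] by (simp add: \<pi>_def)
  qed
  moreover have "M N \<ge> N" using M_mono by (rule strict_mono_imp_increasing)
  ultimately show False using N[of "M N"] F_e[of N] by (metis not_le)
qed

lemma Cauchy_over_finite_sets_subseries_summable:
  fixes y :: "nat \<Rightarrow> 'a::banach"
  assumes Cauchy: "\<And>e. e > 0 \<Longrightarrow> \<exists>N. \<forall>F. finite F \<longrightarrow> F \<subseteq> {N..} \<longrightarrow> norm (sum y F) < e"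
    and p: "strict_mono p"
  shows "summable (\<lambda>k. y (p k))"
  unfolding summable_Cauchy
proof (intro allI impI)
  fix e :: real assume "e > 0"
  then obtain N where N: "\<And>F. finite F \<Longrightarrow> F \<subseteq> {N..} \<Longrightarrow> norm (sum y F) < e"
    using Cauchy by metis
  have "norm (\<Sum>k=m..<n. y (p k)) < e" if "m \<ge> N" for m n
  proof -
    have "inj_on p {m..<n}" using p by (meson inj_on_subset strict_mono_imp_inj_on subset_UNIV)
    then have "(\<Sum>k=m..<n. y (p k)) = sum y (p ` {m..<n})"
      by (simp add: sum.reindex)
    moreover have "N \<le> p k" if "m \<le> k" for k
      using strict_mono_imp_increasing[OF p, of k] \<open>m \<ge> N\<close> that by linarith
    then have "p ` {m..<n} \<subseteq> {N..}" by auto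
    ultimately show ?thesis using N[of "p ` {m..<n}"] by simp
  qed
  then show "\<exists>N. \<forall>m\<ge>N. \<forall>n. norm (\<Sum>k=m..<n. y (p k)) < e" by blast
qed

section \<open>Relocating coordinates\<close>

lemma scaleC_zero_left: "0 *\<^sub>C (v :: 'a::complex_normed_vector) = 0"
  using scaleC_of_real[of 0 v] by simp

lemma blinfun_eq_iff: "g = h \<longleftrightarrow> (\<forall>z. blinfun_apply g z = blinfun_apply h z)"
  by (auto intro: blinfun_eqI)

lemma strict_mono_choice:
  fixes Q :: "nat \<Rightarrow> nat \<Rightarrow> bool"
  assumes "\<And>k N. \<exists>n\<ge>N. Q k n"
  obtains s where "strict_mono s" "\<And>k. Q k (s k)"
proof -
  have "\<exists>s. \<forall>k. Q k (s k) \<and> s k < s (Suc k)"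
    by (rule dependent_nat_choice) (use assms in \<open>meson Suc_le_eq le_refl\<close>)+
  then show ?thesis using that by (auto simp: strict_mono_Suc_iff)
qed

lemma unbounded_infinitely_often:
  fixes h :: "nat \<Rightarrow> real"
  assumes "\<nexists>K. \<forall>n. h n \<le> K"
  shows "\<exists>n\<ge>N. c < h n"
proof (rule ccontr)
  assume "\<not> ?thesis"
  then have le: "h n \<le> c" if "n \<ge> N" for n using that by (meson not_le)
  have "h n \<le> max c (Max (h ` {..<N}))" if "n < N" for n
    using that by (intro max.coboundedI2 Max_ge) auto
  then have "h n \<le> max c (Max (h ` {..<N}))" for n
    using le[of n] by (cases "n < N") auto
  then show False using assms by blast
qed

text \<open>
  The coordinate functionals of a subsymmetric basis, as parameters of operator type, so that their
  continuity is part of the setting; for a shrinking basis it is part of the hypothesis.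
\<close>

locale subsymmetric_coordinates =
  fixes x :: "nat \<Rightarrow> 'a::complex_banach" and f :: "nat \<Rightarrow> 'a \<Rightarrow>\<^sub>L complex"
  assumes expansion: "(\<lambda>n. blinfun_apply (f n) z *\<^sub>C x n) sums z"
    and coord_unique: "(\<lambda>n. a n *\<^sub>C x n) sums z \<Longrightarrow> a n = blinfun_apply (f n) z"
    and rearrangement: "bij \<pi> \<Longrightarrow> summable (\<lambda>n. blinfun_apply (f (\<pi> n)) z *\<^sub>C x (\<pi> n))"
    and subsequence: "strict_mono s \<Longrightarrow>
      summable (\<lambda>n. a n *\<^sub>C x n) \<longleftrightarrow> summable (\<lambda>n. a n *\<^sub>C x (s n))"
begin

lemma biorthogonal: "blinfun_apply (f j) (x i) = (if i = j then 1 else 0)"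
proof -
  define d where "d n = (if i = n then 1 else 0 :: complex)" for n
  have "(\<lambda>n. if n = i then x n else 0) sums x i" by (rule sums_single)
  moreover have "(\<lambda>n. d n *\<^sub>C x n) = (\<lambda>n. if n = i then x n else 0)"
    by (auto simp: d_def scaleC_one scaleC_zero_left)
  ultimately have "(\<lambda>n. d n *\<^sub>C x n) sums x i" by simp
  from coord_unique[OF this, of j] show ?thesis by (simp add: d_def)
qed

lemma basis_nonzero: "x k \<noteq> 0"
  using biorthogonal[of k k] by (auto simp: blinfun.zero_right)

lemma expansion_Cauchy:
  assumes "e > 0"
  shows "\<exists>N. \<forall>F. finite F \<longrightarrow> F \<subseteq> {N..} \<longrightarrow>
    norm (\<Sum>n\<in>F. blinfun_apply (f n) z *\<^sub>C x n) < e"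
  by (rule rearrangements_summable_imp_Cauchy[OF rearrangement assms])

text \<open>
  Passing from \<open>z\<close> to its coordinates along \<open>p\<close> is possible by unconditionality; placing them
  at the positions \<open>q\<close> is possible since both \<open>x \<circ> p\<close> and \<open>x \<circ> q\<close> are equivalent
  to \<open>x\<close>.
\<close>

lemma relocation:
  fixes p q :: "nat \<Rightarrow> nat"
  assumes p: "strict_mono p" and q: "strict_mono q"
  shows "\<exists>w. \<forall>k. blinfun_apply (f (q k)) w = blinfun_apply (f (p k)) z"
proof -
  let ?a = "\<lambda>k. blinfun_apply (f (p k)) z"
  have "summable (\<lambda>k. ?a k *\<^sub>C x (p k))"
    by (rule Cauchy_over_finite_sets_subseries_summable[OF _ p]) (rule expansion_Cauchy)
  then have "summable (\<lambda>k. ?a k *\<^sub>C x (q k))"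
    using subsequence[OF p] subsequence[OF q] by metis
  then obtain w where w: "(\<lambda>k. ?a k *\<^sub>C x (q k)) sums w" by (auto simp: summable_def)
  define c where "c n = (if n \<in> range q then ?a (inv_into UNIV q n) else 0)" for n
  have cq: "c (q k) = ?a k" for k
    using strict_mono_imp_inj_on[OF q] by (simp add: c_def)
  have "(\<lambda>n. c n *\<^sub>C x n) sums w"
    using w sums_mono_reindex[OF q, of "\<lambda>n. c n *\<^sub>C x n" w]
    by (simp add: cq) (simp add: c_def scaleC_zero_left)
  then have "blinfun_apply (f (q k)) w = ?a k" for k
    using coord_unique cq by metis
  then show ?thesis by blast
qed

lemma coordinate_mult_norm_bounded: "\<exists>K. \<forall>n. norm (blinfun_apply (f n) z) * norm (x n) \<le> K"
proof -
  have "(\<lambda>n. blinfun_apply (f n) z *\<^sub>C x n) \<longlonglongrightarrow> 0"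
    using expansion summable_LIMSEQ_zero sums_summable by blast
  then have "Bseq (\<lambda>n. blinfun_apply (f n) z *\<^sub>C x n)"
    by (rule convergent_imp_Bseq[OF convergentI])
  then show ?thesis by (auto simp: Bseq_def norm_scaleC)
qed

text \<open>
  Large coordinates of \<open>z\<close> at sparse positions could be moved to the positions \<open>0, 1, 2, \<dots>\<close>,
  with \<open>x k\<close> receiving a coordinate much larger than \<open>1 / norm (x k)\<close>; the terms of the
  resulting expansion would not be bounded.
\<close>

lemma coordinates_bounded: "\<exists>K. \<forall>n. norm (blinfun_apply (f n) z) \<le> K"
proof (rule ccontr)
  assume "\<not> ?thesis"
  then have "\<exists>n\<ge>N. real k / norm (x k) < norm (blinfun_apply (f n) z)" for k N
    by (rule unbounded_infinitely_often)
  then obtain p where p: "strict_mono p"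
    "\<And>k. real k / norm (x k) < norm (blinfun_apply (f (p k)) z)"
    using strict_mono_choice[of "\<lambda>k n. real k / norm (x k) < norm (blinfun_apply (f n) z)"]
    by blast
  obtain w where w: "\<And>k. blinfun_apply (f k) w = blinfun_apply (f (p k)) z"
    using relocation[OF p(1), of "\<lambda>k. k" z] by (auto simp: strict_mono_def)
  obtain K where K: "\<And>k. norm (blinfun_apply (f k) w) * norm (x k) \<le> K"
    using coordinate_mult_norm_bounded by blast
  obtain k where "K \<le> real k" using real_arch_simple by blast
  then show False using p(2)[of k] K[of k] basis_nonzero[of k]
    by (simp add: w field_simps)
qed

text \<open>
  If the basis were unbounded, some sequence of coefficients would give an absolutely convergent
  series with respect to \<open>x\<close>, but a series with terms of norm above 1 with respect to a rapidly
  growing subsequence.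
\<close>

lemma basis_bounded: "\<exists>K. \<forall>n. norm (x n) \<le> K"
proof (rule ccontr)
  assume "\<not> ?thesis"
  then have "\<exists>n\<ge>N. 2 ^ k * max 1 (norm (x k)) < norm (x n)" for k N
    by (rule unbounded_infinitely_often)
  then obtain s where s: "strict_mono s" "\<And>k. 2 ^ k * max 1 (norm (x k)) < norm (x (s k))"
    using strict_mono_choice[of "\<lambda>k n. 2 ^ k * max 1 (norm (x k)) < norm (x n)"] by blast
  define a where "a k = complex_of_real (1 / (2 ^ k * max 1 (norm (x k))))" for k
  have norm_a: "cmod (a k) = 1 / (2 ^ k * max 1 (norm (x k)))" for k
    unfolding a_def norm_of_real by simp
  have "norm (a k *\<^sub>C x k) \<le> (1/2) ^ k" for k
    by (simp add: norm_scaleC norm_a field_simps max_def)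
  then have "summable (\<lambda>k. a k *\<^sub>C x k)"
    by (rule summable_comparison_test'[of "\<lambda>k. (1/2) ^ k :: real" 0, rotated])
      (simp add: summable_geometric)
  then have "(\<lambda>k. a k *\<^sub>C x (s k)) \<longlonglongrightarrow> 0"
    using subsequence[OF s(1)] summable_LIMSEQ_zero by blast
  then have "\<exists>N. \<forall>n\<ge>N. norm (a n *\<^sub>C x (s n) - 0) < 1" by (rule LIMSEQ_D) simp
  then obtain k where "norm (a k *\<^sub>C x (s k)) < 1" by auto
  moreover have "norm (a k *\<^sub>C x (s k)) > 1"
    using s(2)[of k] by (simp add: norm_scaleC norm_a field_simps)
  ultimately show False by simp
qed

text \<open>
  The gliding hump argument.  It yields an increasing \<open>s\<close> on an infinite set \<open>D\<close> that moves
  pieces \<open>A k\<close> of \<open>D\<close> into disjoint intervals, so that the pieces of \<open>z\<close> have norm at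
  least 1 after the move; but there is a vector \<open>w\<close> that has the moved coordinates.
\<close>

lemma relocation_pointwise_bounded:
  "\<exists>K. \<forall>A \<sigma>. finite A \<longrightarrow> strict_mono_on A \<sigma> \<longrightarrow>
    norm (\<Sum>i\<in>A. blinfun_apply (f i) z *\<^sub>C x (\<sigma> i)) \<le> K"
proof (rule ccontr)
  let ?S = "\<lambda>A \<sigma>. \<Sum>i\<in>A. blinfun_apply (f i) z *\<^sub>C x (\<sigma> i)"
  assume "\<not> ?thesis"
  then have unbounded: "\<exists>A \<sigma>. finite A \<and> strict_mono_on A \<sigma> \<and> norm (?S A \<sigma>) > K" for K :: real
    by (meson not_le)
  obtain K1 where K1: "\<And>n. norm (blinfun_apply (f n) z) \<le> K1" using coordinates_bounded by blast
  obtain K2 where K2: "\<And>n. norm (x n) \<le> K2" using basis_bounded by blast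
  \<comment> \<open>relocations that neither start nor end below \<open>N\<close>, and are not small at \<open>z\<close>\<close>
  define far where "far N A \<sigma> \<longleftrightarrow> finite A \<and> strict_mono_on A \<sigma> \<and> A \<subseteq> {N..} \<and> \<sigma> ` A \<subseteq> {N..} \<and>
      norm (?S A \<sigma>) \<ge> 1" for N A \<sigma>
  have "\<exists>A \<sigma>. far N A \<sigma>" for N
  proof -
    have K12: "K1 \<ge> 0" "K2 \<ge> 0" using K1[of 0] K2[of 0] norm_ge_zero order_trans by blast+
    obtain A \<sigma> where A: "finite A" "strict_mono_on A \<sigma>"
      "norm (?S A \<sigma>) > 1 + real (2 * N) * (K1 * K2)"
      using unbounded by blast
    \<comment> \<open>at most \<open>2 N\<close> indices are removed, each contributing at most \<open>K1 * K2\<close> to the norm\<close>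
    define R where "R = {i\<in>A. i < N} \<union> {i\<in>A. \<sigma> i < N}"
    have "inj_on \<sigma> {i\<in>A. \<sigma> i < N}"
      using strict_mono_on_imp_inj_on[OF A(2)] by (rule inj_on_subset) auto
    then have "card {i\<in>A. \<sigma> i < N} \<le> card {..<N}"
      by (rule card_inj_on_le) auto
    moreover have "card {i\<in>A. i < N} \<le> card {..<N}" by (rule card_mono) auto
    ultimately have "card R \<le> 2 * N"
      using card_Un_le[of "{i\<in>A. i < N}" "{i\<in>A. \<sigma> i < N}"] by (simp add: R_def)
    have "norm (?S R \<sigma>) \<le> (\<Sum>i\<in>R. K1 * K2)"
      by (intro sum_norm_le) (auto simp: norm_scaleC intro!: mult_mono K1 K2 K12)
    also have "\<dots> \<le> real (2 * N) * (K1 * K2)"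
      using \<open>card R \<le> 2 * N\<close> K12 by (simp only: sum_constant) (intro mult_right_mono; simp)
    finally have "norm (?S R \<sigma>) \<le> real (2 * N) * (K1 * K2)" .
    moreover have "?S A \<sigma> = ?S (A - R) \<sigma> + ?S R \<sigma>"
      using A(1) by (intro sum.subset_diff) (auto simp: R_def)
    ultimately have "norm (?S (A - R) \<sigma>) \<ge> 1"
      using A(3) norm_triangle_ineq[of "?S (A - R) \<sigma>" "?S R \<sigma>"] by simp
    moreover have "A - R \<subseteq> {N..}" "\<sigma> ` (A - R) \<subseteq> {N..}" by (auto simp: R_def)
    moreover have "strict_mono_on (A - R) \<sigma>" using A(2) by (rule monotone_on_subset) auto
    ultimately show ?thesis using A(1) unfolding far_def by blast
  qed
  then obtain B \<tau> where "\<And>N. far N (B N) (\<tau> N)" by metis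
  then have B: "finite (B N)" "strict_mono_on (B N) (\<tau> N)"
    "B N \<subseteq> {N..}" "\<tau> N ` B N \<subseteq> {N..}" "norm (?S (B N) (\<tau> N)) \<ge> 1" for N
    by (simp_all add: far_def)
  define M where "M = rec_nat 0 (\<lambda>_ N. Suc (Max (B N \<union> \<tau> N ` B N)))"
  define A where "A k = B (M k)" for k
  define \<sigma> where "\<sigma> k = \<tau> (M k)" for k
  have M0: "M 0 = 0" and MS: "M (Suc k) = Suc (Max (A k \<union> \<sigma> k ` A k))" for k
    by (auto simp: M_def A_def \<sigma>_def)
  have A_fin: "finite (A k)" and \<sigma>_mono: "strict_mono_on (A k) (\<sigma> k)"
    and A_norm: "norm (?S (A k) (\<sigma> k)) \<ge> 1" for k
    using B by (auto simp: A_def \<sigma>_def)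
  have block: "A k \<union> \<sigma> k ` A k \<subseteq> {M k..<M (Suc k)}" for k
  proof -
    have "finite (A k \<union> \<sigma> k ` A k)" using A_fin by simp
    from Max_ge[OF this] have "A k \<union> \<sigma> k ` A k \<subseteq> {..<M (Suc k)}"
      unfolding MS lessThan_Suc_atMost by blast
    moreover have "A k \<union> \<sigma> k ` A k \<subseteq> {M k..}" using B(3,4) by (simp add: A_def \<sigma>_def)
    moreover have "{M k..<M (Suc k)} = {M k..} \<inter> {..<M (Suc k)}" by auto
    ultimately show ?thesis by blast
  qed
  have A_ne: "A k \<noteq> {}" for k using A_norm[of k] by auto
  then have "M k < M (Suc k)" for k using block[of k] by fastforce
  then have M_mono: "strict_mono M" by (simp add: strict_mono_Suc_iff)
  obtain J where "\<And>n. M (J n) \<le> n \<and> n < M (Suc (J n))"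
    and J: "\<And>n k. M k \<le> n \<Longrightarrow> n < M (Suc k) \<Longrightarrow> J n = k"
    using strict_mono_block_ex[OF M_mono M0] by blast
  \<comment> \<open>the maps \<open>\<sigma> k\<close> agree with one map that is increasing across the blocks\<close>
  define s where "s i = \<sigma> (J i) i" for i
  define D where "D = (\<Union>k. A k)"
  have sA: "s i = \<sigma> k i" if "i \<in> A k" for i k
    using that block[of k] J[of k i] by (auto simp: s_def)
  have s_mono: "s i < s j" if ij: "i \<in> D" "j \<in> D" "i < j" for i j
  proof -
    obtain k l where kl: "i \<in> A k" "j \<in> A l" using ij by (auto simp: D_def)
    consider "k = l" | "k < l" | "l < k" by linarith
    then show ?thesis
    proof cases
      case 1
      then show ?thesis using kl ij(3) \<sigma>_mono[of k] by (auto simp: sA[of _ k] dest: strict_mono_onD)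
    next
      case 2
      have "s i < M (Suc k)" "M l \<le> s j"
        using kl block[of k] block[of l] by (auto simp: sA[of i k] sA[of j l])
      moreover have "M (Suc k) \<le> M l" using 2 M_mono by (simp add: strict_mono_less_eq)
      ultimately show ?thesis by linarith
    next
      case 3
      have "j < M (Suc l)" "M k \<le> i" using kl block[of k] block[of l] by auto
      moreover have "M (Suc l) \<le> M k" using 3 M_mono by (simp add: strict_mono_less_eq)
      ultimately show ?thesis using ij(3) by linarith
    qed
  qed
  have D_inf: "infinite D"
    unfolding infinite_nat_iff_unbounded_le
  proof
    fix m
    obtain i where i: "i \<in> A m" using A_ne by blast
    then have "M m \<le> i" "i \<in> D" using block[of m] by (auto simp: D_def)
    moreover have "m \<le> M m" using M_mono by (rule strict_mono_imp_increasing)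
    ultimately show "\<exists>i\<ge>m. i \<in> D" using order_trans by blast
  qed
  define p where "p = enumerate D"
  have p: "strict_mono p" "range p = D" "strict_mono (s \<circ> p)"
  proof -
    show p1: "strict_mono p" using D_inf by (simp add: p_def strict_mono_enumerate)
    show p2: "range p = D" using D_inf by (simp add: p_def range_enumerate)
    show "strict_mono (s \<circ> p)" using p1 p2 s_mono by (auto simp: strict_mono_def)
  qed
  obtain w where w: "\<And>k. blinfun_apply (f (s (p k))) w = blinfun_apply (f (p k)) z"
    using relocation[OF p(1,3), of z] by auto
  then have ws: "blinfun_apply (f (s i)) w = blinfun_apply (f i) z" if "i \<in> D" for i
    using that p(2) by (metis imageE)
  obtain N where N: "\<And>F. finite F \<Longrightarrow> F \<subseteq> {N..} \<Longrightarrow>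
      norm (\<Sum>n\<in>F. blinfun_apply (f n) w *\<^sub>C x n) < 1"
    using expansion_Cauchy[of 1 w] by auto
  have AD: "A N \<subseteq> D" by (auto simp: D_def)
  have "inj_on s (A N)"
    using AD s_mono by (intro strict_mono_on_imp_inj_on strict_mono_onI) blast
  then have "(\<Sum>n\<in>s ` A N. blinfun_apply (f n) w *\<^sub>C x n)
      = (\<Sum>i\<in>A N. blinfun_apply (f (s i)) w *\<^sub>C x (s i))"
    by (simp add: sum.reindex)
  also have "\<dots> = ?S (A N) (\<sigma> N)"
    using AD by (intro sum.cong refl) (simp add: ws subset_iff flip: sA)
  finally have "norm (\<Sum>n\<in>s ` A N. blinfun_apply (f n) w *\<^sub>C x n) \<ge> 1"
    using A_norm[of N] by simp
  moreover have "s ` A N \<subseteq> {N..}"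
  proof -
    have "N \<le> M N" using M_mono by (rule strict_mono_imp_increasing)
    moreover have "s ` A N = \<sigma> N ` A N" by (intro image_cong) (auto simp: sA)
    moreover have "\<sigma> N ` A N \<subseteq> {M N..<M (Suc N)}" using block[of N] by blast
    ultimately show ?thesis by auto
  qed
  ultimately show False using N[of "s ` A N"] A_fin[of N] by fastforce
qed

lemma rank_one_sum_apply:
  "blinfun_apply (\<Sum>i\<in>A. rank_one (x (\<sigma> i)) (f i)) z =
    (\<Sum>i\<in>A. blinfun_apply (f i) z *\<^sub>C x (\<sigma> i))"
  by (simp add: blinfun.sum_left rank_one.rep_eq)

lemma relocation_uniformly_bounded:
  "\<exists>C. \<forall>A \<sigma> z. finite A \<longrightarrow> strict_mono_on A \<sigma> \<longrightarrow>
    norm (\<Sum>i\<in>A. blinfun_apply (f i) z *\<^sub>C x (\<sigma> i)) \<le> C * norm z"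
proof -
  define S where "S = {(\<Sum>i\<in>A. rank_one (x (\<sigma> i)) (f i)) | A \<sigma>. finite A \<and> strict_mono_on A \<sigma>}"
  have "\<exists>K. \<forall>T\<in>S. norm (blinfun_apply T z) \<le> K" for z
  proof -
    obtain K where "\<And>A \<sigma>. finite A \<Longrightarrow> strict_mono_on A \<sigma> \<Longrightarrow>
        norm (\<Sum>i\<in>A. blinfun_apply (f i) z *\<^sub>C x (\<sigma> i)) \<le> K"
      using relocation_pointwise_bounded by blast
    then show ?thesis by (intro exI[of _ K]) (auto simp: S_def rank_one_sum_apply)
  qed
  then obtain C where C: "\<And>T. T \<in> S \<Longrightarrow> norm T \<le> C" using uniform_boundedness[of S] by blast
  have "norm (\<Sum>i\<in>A. blinfun_apply (f i) z *\<^sub>C x (\<sigma> i)) \<le> C * norm z"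
    if "finite A" "strict_mono_on A \<sigma>" for A \<sigma> z
  proof -
    let ?T = "\<Sum>i\<in>A. rank_one (x (\<sigma> i)) (f i)"
    have "?T \<in> S" using that by (auto simp: S_def)
    then have "norm ?T * norm z \<le> C * norm z" by (intro mult_right_mono C) auto
    then show ?thesis using norm_blinfun[of ?T z] by (simp add: rank_one_sum_apply)
  qed
  then show ?thesis by blast
qed

end

section \<open>The group of signed cyclic shifts\<close>

definition signed_shift :: "nat \<Rightarrow> (nat \<Rightarrow> complex) \<Rightarrow> nat \<Rightarrow> complex mat"
  where "signed_shift n t k = mat n n (\<lambda>(i, j). if i = (j + k) mod n then t j else 0)"

definition signed_shifts :: "nat \<Rightarrow> complex mat set"
  where "signed_shifts n = {signed_shift n t k | t k. \<forall>j. t j \<in> {1, -1}}"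

lemma signed_shift_carrier: "signed_shift n t k \<in> carrier_mat n n"
  by (simp add: signed_shift_def)

lemma signed_shift_in_signed_shifts:
  "(\<And>j. t j \<in> {1, -1}) \<Longrightarrow> signed_shift n t k \<in> signed_shifts n"
  unfolding signed_shifts_def by blast

lemma signed_shift_mult:
  assumes n: "n > 0"
  shows "signed_shift n t k * signed_shift n u l =
    signed_shift n (\<lambda>j. t ((j + l) mod n) * u j) (k + l)"
proof (rule eq_matI)
  let ?R = "signed_shift n (\<lambda>j. t ((j + l) mod n) * u j) (k + l)"
  fix i j assume "i < dim_row ?R" "j < dim_col ?R"
  then have ij: "i < n" "j < n" by (simp_all add: signed_shift_def)
  have "(signed_shift n t k * signed_shift n u l) $$ (i, j) =
      (\<Sum>m = 0..<n. (if i = (m + k) mod n then t m else 0) * (if m = (j + l) mod n then u j else 0))"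
    using ij by (simp add: signed_shift_def scalar_prod_def)
  also have "\<dots> = (\<Sum>m = 0..<n. if m = (j + l) mod n then (if i = (m + k) mod n then t m else 0) * u j else 0)"
    by (intro sum.cong) auto
  also have "\<dots> = (if i = ((j + l) mod n + k) mod n then t ((j + l) mod n) else 0) * u j"
    using n by simp
  also have "((j + l) mod n + k) mod n = (j + (k + l)) mod n"
    unfolding mod_add_left_eq by (simp add: ac_simps)
  finally show "(signed_shift n t k * signed_shift n u l) $$ (i, j) = ?R $$ (i, j)"
    using ij by (simp add: signed_shift_def)
qed (simp_all add: signed_shift_def)

lemma signed_shift_one:
  assumes "\<And>j. j < n \<Longrightarrow> t j = 1" "n dvd k"
  shows "signed_shift n t k = 1\<^sub>m n"
proof (rule eq_matI)
  fix i j assume "i < dim_row (1\<^sub>m n)" "j < dim_col (1\<^sub>m n)"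
  moreover have "(j + k) mod n = j mod n" using assms(2) by auto
  ultimately show "signed_shift n t k $$ (i, j) = (1\<^sub>m n :: complex mat) $$ (i, j)"
    using assms(1)[of j] by (auto simp: signed_shift_def)
qed (simp_all add: signed_shift_def)

text \<open>
  The inverse of a shift by \<open>k\<close> is the shift by \<open>(n - 1) k\<close>, which is congruent to \<open>- k\<close>
  modulo \<open>n\<close>, with each sign transported along.
\<close>

lemma signed_shift_mult_inverse:
  assumes n: "n > 0" and t: "\<And>j. t j \<in> {1, -1}"
  shows "\<exists>h\<in>signed_shifts n. signed_shift n t k * h = 1\<^sub>m n \<and> h * signed_shift n t k = 1\<^sub>m n"
proof -
  define l where "l = (n - 1) * k"
  define u where "u j = t ((j + l) mod n)" for j
  have kl: "k + l = n * k" using n by (cases n) (auto simp: l_def)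
  have sq: "t j * t j = 1" for j using t[of j] by auto
  have "signed_shift n t k * signed_shift n u l = 1\<^sub>m n"
    unfolding signed_shift_mult[OF n] by (rule signed_shift_one) (simp_all add: u_def sq kl)
  moreover have "signed_shift n u l * signed_shift n t k = 1\<^sub>m n"
    unfolding signed_shift_mult[OF n]
  proof (rule signed_shift_one)
    fix j assume "j < n"
    have "((j + k) mod n + l) mod n = (j + (k + l)) mod n"
      unfolding mod_add_left_eq by (simp add: ac_simps)
    also have "\<dots> = j" using \<open>j < n\<close> by (simp add: kl)
    finally show "u ((j + k) mod n) * t j = 1" by (simp add: u_def sq)
  qed (simp add: kl add.commute)
  moreover have "signed_shift n u l \<in> signed_shifts n"
    using t by (intro signed_shift_in_signed_shifts) (simp add: u_def)
  ultimately show ?thesis by blast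
qed

lemma finite_signed_shifts:
  assumes n: "n > 0"
  shows "finite (signed_shifts n)"
proof (rule finite_subset)
  \<comment> \<open>only the residue of \<open>k\<close> and the signs below \<open>n\<close> matter\<close>
  let ?T = "PiE {..<n} (\<lambda>_. {1, -1 :: complex})"
  show "finite ((\<lambda>(t, k). signed_shift n t k) ` (?T \<times> {..<n}))"
    by (intro finite_imageI finite_cartesian_product finite_PiE) auto
  show "signed_shifts n \<subseteq> (\<lambda>(t, k). signed_shift n t k) ` (?T \<times> {..<n})"
  proof
    fix g assume "g \<in> signed_shifts n"
    then obtain t k where g: "g = signed_shift n t k" and t: "\<And>j. t j \<in> {1, -1}"
      unfolding signed_shifts_def by auto
    have "g = signed_shift n (restrict t {..<n}) (k mod n)"
      unfolding g signed_shift_def by (rule eq_matI) (auto simp: mod_add_right_eq)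
    moreover have "restrict t {..<n} \<in> ?T" using t by auto
    ultimately show "g \<in> (\<lambda>(t, k). signed_shift n t k) ` (?T \<times> {..<n})"
      using n by (intro image_eqI[of _ _ "(restrict t {..<n}, k mod n)"]) auto
  qed
qed

lemma subgroup_signed_shifts:
  assumes n: "n > 0"
  shows "subgroup (signed_shifts n) (units_of (ring_mat TYPE(complex) n ()))"
proof -
  define R where "R = ring_mat TYPE(complex) n ()"
  interpret R: ring R unfolding R_def by (rule ring_mat)
  have R_simps: "carrier R = carrier_mat n n" "mult R = (*)" "one R = 1\<^sub>m n"
    by (simp_all add: R_def ring_mat_simps)
  have carrier: "g \<in> carrier R" if "g \<in> signed_shifts n" for g
    using that by (auto simp: signed_shifts_def R_simps signed_shift_carrier)
  have inverse: "\<exists>h\<in>signed_shifts n. g * h = 1\<^sub>m n \<and> h * g = 1\<^sub>m n" if "g \<in> signed_shifts n" for g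
    using that signed_shift_mult_inverse[OF n] by (auto simp: signed_shifts_def)
  have units: "signed_shifts n \<subseteq> Units R"
    using carrier inverse unfolding Units_def by (fastforce simp: R_simps)
  have "subgroup (signed_shifts n) (units_of R)"
  proof (rule group.subgroupI[OF R.units_group])
    show "signed_shifts n \<subseteq> carrier (units_of R)" using units by (simp add: units_of_carrier)
    show "signed_shifts n \<noteq> {}" using signed_shift_in_signed_shifts[of "\<lambda>_. 1" n 0] by auto
    show "inv\<^bsub>units_of R\<^esub> g \<in> signed_shifts n" if g: "g \<in> signed_shifts n" for g
    proof -
      obtain h where h: "h \<in> signed_shifts n" "g * h = 1\<^sub>m n" "h * g = 1\<^sub>m n"
        using inverse[OF g] by blast
      have "inv\<^bsub>R\<^esub> g = h" using h g carrier by (intro R.inv_char) (auto simp: R_simps)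
      then show ?thesis using h(1) g units R.units_of_inv[of g] by auto
    qed
    show "g \<otimes>\<^bsub>units_of R\<^esub> h \<in> signed_shifts n"
      if gh: "g \<in> signed_shifts n" "h \<in> signed_shifts n" for g h
    proof -
      obtain t k where g: "g = signed_shift n t k" and t: "\<And>j. t j \<in> {1, -1}"
        using gh(1) unfolding signed_shifts_def by auto
      obtain u l where h: "h = signed_shift n u l" and u: "\<And>j. u j \<in> {1, -1}"
        using gh(2) unfolding signed_shifts_def by auto
      have "t ((j + l) mod n) * u j \<in> {1, -1}" for j
        using t[of "(j + l) mod n"] u[of j] by auto
      then show ?thesis
        unfolding g h units_of_mult R_simps signed_shift_mult[OF n]
        by (rule signed_shift_in_signed_shifts)
    qed
  qed
  then show ?thesis by (simp add: R_def)
qed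

text \<open>
  Let \<open>U\<close> be the shift that takes \<open>b\<close> to \<open>a\<close>, and \<open>V\<close> the same shift with the sign at
  \<open>b\<close> reversed.  All entries of \<open>U - V\<close> cancel except the one at \<open>(a, b)\<close>, which is 2.
\<close>

lemma matrix_unit_in_span_signed_shifts:
  assumes a: "a < n" and b: "b < n"
  shows "\<exists>c. \<forall>i<n. \<forall>j<n. (\<Sum>g\<in>signed_shifts n. c g * g $$ (i, j)) =
    (if i = a \<and> j = b then 1 else 0)"
proof -
  have n: "n > 0" using a by simp
  define k where "k = a + (n - b)"
  define U where "U = signed_shift n (\<lambda>_. 1) k"
  define V where "V = signed_shift n (\<lambda>j. if j = b then -1 else 1) k"
  define c where "c g = (if g = U then 1 / 2 else 0) - (if g = V then 1 / 2 else 0 :: complex)" for g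
  have UV: "U \<in> signed_shifts n" "V \<in> signed_shifts n"
    unfolding U_def V_def by (intro signed_shift_in_signed_shifts; simp)+
  have "(b + k) mod n = (a + n) mod n" using b by (simp add: k_def)
  then have bk: "(b + k) mod n = a" using a by simp
  have "(\<Sum>g\<in>signed_shifts n. c g * g $$ (i, j)) = (if i = a \<and> j = b then 1 else 0)"
    if ij: "i < n" "j < n" for i j
  proof -
    have "(\<Sum>g\<in>signed_shifts n. c g * g $$ (i, j)) =
        (\<Sum>g\<in>signed_shifts n. (if g = U then U $$ (i, j) / 2 else 0) - (if g = V then V $$ (i, j) / 2 else 0))"
      by (intro sum.cong) (auto simp: c_def)
    also have "\<dots> = U $$ (i, j) / 2 - V $$ (i, j) / 2"
      using UV finite_signed_shifts[OF n] by (simp add: sum_subtractf)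
    also have "\<dots> = (if i = a \<and> j = b then 1 else 0)"
      using ij bk by (auto simp: U_def V_def signed_shift_def)
    finally show ?thesis .
  qed
  then show ?thesis by blast
qed

lemma irreducible_signed_shifts:
  assumes n: "n > 0"
  shows "irreducible_matrix_group n (signed_shifts n)"
  unfolding irreducible_matrix_group_def
proof (intro conjI ballI)
  show "finite (signed_shifts n)" using n by (rule finite_signed_shifts)
  show "subgroup (signed_shifts n) (units_of (ring_mat TYPE(complex) n ()))"
    using n by (rule subgroup_signed_shifts)
  fix A :: "complex mat" assume A: "A \<in> carrier_mat n n"
  define unit_coeffs where "unit_coeffs a b c \<longleftrightarrow> (\<forall>i<n. \<forall>j<n.
      (\<Sum>g\<in>signed_shifts n. c g * g $$ (i, j)) = (if i = a \<and> j = b then 1 else 0))" for a b c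
  have "\<exists>c. unit_coeffs a b c" if "a < n" "b < n" for a b
    unfolding unit_coeffs_def using that by (rule matrix_unit_in_span_signed_shifts)
  then obtain e where "\<And>a b. a < n \<Longrightarrow> b < n \<Longrightarrow> unit_coeffs a b (e a b)" by metis
  then have e: "(\<Sum>g\<in>signed_shifts n. e a b g * g $$ (i, j)) = (if i = a \<and> j = b then 1 else 0)"
    if "a < n" "b < n" "i < n" "j < n" for a b i j
    using that by (simp add: unit_coeffs_def)
  define c where "c g = (\<Sum>a<n. \<Sum>b<n. A $$ (a, b) * e a b g)" for g
  have "(\<Sum>g\<in>signed_shifts n. c g * g $$ (i, j)) = A $$ (i, j)" if ij: "i < n" "j < n" for i j
  proof -
    have "(\<Sum>g\<in>signed_shifts n. c g * g $$ (i, j)) =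
        (\<Sum>g\<in>signed_shifts n. \<Sum>a<n. \<Sum>b<n. A $$ (a, b) * (e a b g * g $$ (i, j)))"
      by (simp add: c_def sum_distrib_right mult.assoc)
    also have "\<dots> = (\<Sum>a<n. \<Sum>g\<in>signed_shifts n. \<Sum>b<n. A $$ (a, b) * (e a b g * g $$ (i, j)))"
      by (rule sum.swap)
    also have "\<dots> = (\<Sum>a<n. \<Sum>b<n. \<Sum>g\<in>signed_shifts n. A $$ (a, b) * (e a b g * g $$ (i, j)))"
      by (intro sum.cong refl sum.swap)
    also have "\<dots> = (\<Sum>a<n. \<Sum>b<n. A $$ (a, b) * (if i = a \<and> j = b then 1 else 0))"
      using ij by (intro sum.cong refl) (simp add: e flip: sum_distrib_left)
    also have "\<dots> = (\<Sum>a<n. \<Sum>b<n. if b = j then (if a = i then A $$ (a, b) else 0) else 0)"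
      by (intro sum.cong refl) auto
    also have "\<dots> = A $$ (i, j)" using ij by simp
    finally show ?thesis .
  qed
  then show "\<exists>c. A = mat n n (\<lambda>(i, j). \<Sum>g\<in>signed_shifts n. c g * g $$ (i, j))"
    using A by (intro exI[of _ c] eq_matI) auto
qed

lemma one_in_signed_shifts: "1\<^sub>m n \<in> signed_shifts n"
  using signed_shift_one[of n "\<lambda>_. 1" 0] signed_shift_in_signed_shifts[of "\<lambda>_. 1" n 0] by simp

section \<open>Signed cyclic shifts act uniformly boundedly\<close>

context subsymmetric_coordinates
begin

lemma matrix_operator_signed_shift:
  assumes n: "n > 0"
  shows "blinfun_apply (matrix_operator n x f (signed_shift n t k)) z =
    (\<Sum>j<n. t j *\<^sub>C blinfun_apply (f j) z *\<^sub>C x ((j + k) mod n))"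
proof -
  have "blinfun_apply (matrix_operator n x f (signed_shift n t k)) z =
      (\<Sum>i<n. \<Sum>j<n. signed_shift n t k $$ (i, j) *\<^sub>C blinfun_apply (f j) z *\<^sub>C x i)"
    by (simp add: matrix_operator_def blinfun.sum_left scaleC_blinfun.rep_eq rank_one.rep_eq)
  also have "\<dots> = (\<Sum>i<n. \<Sum>j<n. if i = (j + k) mod n then
      t j *\<^sub>C blinfun_apply (f j) z *\<^sub>C x ((j + k) mod n) else 0)"
    by (intro sum.cong refl) (auto simp: signed_shift_def scaleC_zero_left)
  also have "\<dots> = (\<Sum>j<n. \<Sum>i<n. if i = (j + k) mod n then
      t j *\<^sub>C blinfun_apply (f j) z *\<^sub>C x ((j + k) mod n) else 0)"
    by (rule sum.swap)
  also have "\<dots> = (\<Sum>j<n. t j *\<^sub>C blinfun_apply (f j) z *\<^sub>C x ((j + k) mod n))"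
    using n by simp
  finally show ?thesis .
qed

text \<open>
  The indices below \<open>n\<close> split into four sets, according to whether the shift wraps around and
  according to the sign.  On each of them the shift is increasing and the sign is constant.
\<close>

lemma signed_shifts_uniformly_bounded:
  "\<exists>K. \<forall>n>0. \<forall>g\<in>signed_shifts n. norm (matrix_operator n x f g) \<le> K"
proof -
  obtain C where C: "\<And>A \<sigma> z. finite A \<Longrightarrow> strict_mono_on A \<sigma> \<Longrightarrow>
      norm (\<Sum>i\<in>A. blinfun_apply (f i) z *\<^sub>C x (\<sigma> i)) \<le> C * norm z"
    using relocation_uniformly_bounded by blast
  have "norm (matrix_operator n x f g) \<le> 4 * \<bar>C\<bar>"
    if n: "n > 0" and g: "g \<in> signed_shifts n" for n g
  proof (rule norm_blinfun_bound)
    fix z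
    obtain t k where g: "g = signed_shift n t k" and t: "\<And>j. t j \<in> {1, -1}"
      using g unfolding signed_shifts_def by auto
    define v where "v j = t j *\<^sub>C blinfun_apply (f j) z *\<^sub>C x ((j + k) mod n)" for j
    define T where "T = {j. t j = 1}"
    \<comment> \<open>the indices at which the shift does not wrap around\<close>
    define B where "B = {j. j + k mod n < n}"
    have shift: "(j + k) mod n = (if j \<in> B then j + k mod n else j + k mod n - n)"
      if "j < n" for j
    proof -
      have "(j + k) mod n = (j + k mod n) mod n" by (simp add: mod_add_right_eq)
      moreover have "j + k mod n - n < n" using that mod_less_divisor[OF n, of k] by linarith
      ultimately show ?thesis by (simp add: B_def le_mod_geq)
    qed
    have piece: "norm (sum v D) \<le> C * norm z"
      if D: "D \<subseteq> {..<n}" and c: "\<And>j. j \<in> D \<Longrightarrow> t j = c" "c \<in> {1, -1}"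
        and DB: "D \<subseteq> B \<or> D \<inter> B = {}" for D c
    proof -
      have fin: "finite D" using D finite_subset by blast
      have "strict_mono_on D (\<lambda>j. (j + k) mod n)"
      proof (rule strict_mono_onI)
        fix i j assume "i \<in> D" "j \<in> D" "i < j"
        then show "(i + k) mod n < (j + k) mod n"
          using D DB by (auto simp: shift subset_iff disjoint_iff) (auto simp: B_def)
      qed
      then have "norm (\<Sum>j\<in>D. blinfun_apply (f j) z *\<^sub>C x ((j + k) mod n)) \<le> C * norm z"
        by (rule C[OF fin])
      moreover have "sum v D = c *\<^sub>C (\<Sum>j\<in>D. blinfun_apply (f j) z *\<^sub>C x ((j + k) mod n))"
        by (simp add: v_def c(1) linear_sum[OF bounded_linear.linear[OF bounded_linear_scaleC_right]])
      ultimately show ?thesis using c(2) by (auto simp: norm_scaleC)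
    qed
    have t': "t j = -1" if "j \<notin> T" for j using t[of j] that by (auto simp: T_def)
    let ?N = "{..<n}"
    have "sum v ?N = sum v (?N \<inter> B) + sum v (?N - B)" by (rule sum.Int_Diff) simp
    also have "sum v (?N \<inter> B) = sum v (?N \<inter> B \<inter> T) + sum v (?N \<inter> B - T)"
      by (rule sum.Int_Diff) simp
    also have "sum v (?N - B) = sum v ((?N - B) \<inter> T) + sum v (?N - B - T)"
      by (rule sum.Int_Diff) simp
    finally have "norm (sum v ?N) \<le> (norm (sum v (?N \<inter> B \<inter> T)) + norm (sum v (?N \<inter> B - T)))
        + (norm (sum v ((?N - B) \<inter> T)) + norm (sum v (?N - B - T)))"
      by (metis norm_triangle_mono order_refl)
    moreover have "norm (sum v (?N \<inter> B \<inter> T)) \<le> C * norm z"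
      by (rule piece[of _ 1]) (auto simp: T_def)
    moreover have "norm (sum v (?N \<inter> B - T)) \<le> C * norm z"
      by (rule piece[of _ "-1"]) (auto simp: t')
    moreover have "norm (sum v ((?N - B) \<inter> T)) \<le> C * norm z"
      by (rule piece[of _ 1]) (auto simp: T_def)
    moreover have "norm (sum v (?N - B - T)) \<le> C * norm z"
      by (rule piece[of _ "-1"]) (auto simp: t')
    moreover have "C * norm z \<le> \<bar>C\<bar> * norm z" by (intro mult_right_mono) auto
    ultimately have "norm (sum v ?N) \<le> 4 * \<bar>C\<bar> * norm z" by linarith
    then show "norm (blinfun_apply (matrix_operator n x f g) z) \<le> 4 * \<bar>C\<bar> * norm z"
      by (simp add: g matrix_operator_signed_shift[OF n] v_def)
  qed simp
  then show ?thesis by blast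
qed

lemma projection_apply:
  assumes "n > 0"
  shows "blinfun_apply (matrix_operator n x f (1\<^sub>m n)) z = (\<Sum>i<n. blinfun_apply (f i) z *\<^sub>C x i)"
  using matrix_operator_signed_shift[OF assms, of "\<lambda>_. 1" 0 z]
  by (simp add: signed_shift_one scaleC_one)

lemma projection_tendsto:
  "(\<lambda>l. blinfun_apply (matrix_operator (Suc l) x f (1\<^sub>m (Suc l))) z) \<longlonglongrightarrow> z"
  using LIMSEQ_Suc[OF expansion[of z, unfolded sums_def]] by (simp add: projection_apply)

text \<open>
  The adjoint of the projection fixes \<open>f m\<close> as soon as the projection reaches index \<open>m\<close>, hence
  eventually fixes each element of the span; uniform boundedness extends the convergence to the
  closure.
\<close>

lemma adjoint_projection_tendsto:
  assumes cd: "\<And>n. f n \<in> cdual" and \<phi>: "\<phi> \<in> closure (cspan (range f))"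
  shows "(\<lambda>l. \<phi> o\<^sub>L matrix_operator (Suc l) x f (1\<^sub>m (Suc l))) \<longlonglongrightarrow> \<phi>"
proof -
  interpret dual: vector_space "scaleC :: complex \<Rightarrow> ('a \<Rightarrow>\<^sub>L complex) \<Rightarrow> _"
    by (rule vector_space_scaleC)
  define P where "P l = matrix_operator (Suc l) x f (1\<^sub>m (Suc l))" for l
  have P_apply: "blinfun_apply (P l) z = (\<Sum>i<Suc l. blinfun_apply (f i) z *\<^sub>C x i)" for l z
    unfolding P_def by (simp add: projection_apply)
  obtain K where "\<forall>n>0. \<forall>g\<in>signed_shifts n. norm (matrix_operator n x f g) \<le> K"
    using signed_shifts_uniformly_bounded by blast
  then have K: "norm (P l) \<le> K" for l
    using one_in_signed_shifts[of "Suc l"] by (simp add: P_def)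
  have K0: "K \<ge> 0" using K[of 0] norm_ge_zero order_trans by blast
  have fixed: "\<exists>L. \<forall>l\<ge>L. \<psi> o\<^sub>L P l = \<psi>" if "\<psi> \<in> cspan (range f)" for \<psi>
    using that
  proof (induction rule: dual.span_induct_alt)
    case base
    show ?case by (auto intro!: blinfun_eqI)
  next
    case (step c \<eta> \<psi>)
    then obtain m L where m: "\<eta> = f m" and L: "\<And>l. l \<ge> L \<Longrightarrow> \<psi> o\<^sub>L P l = \<psi>" by auto
    have "f m o\<^sub>L P l = f m" if "l \<ge> m" for l
    proof (rule blinfun_eqI)
      fix z
      have "blinfun_apply (f m o\<^sub>L P l) z =
          (\<Sum>i<Suc l. blinfun_apply (f i) z * blinfun_apply (f m) (x i))"
        using cd[of m] by (simp add: P_apply blinfun.sum_right cdual_def blinfun.add_right)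
      also have "\<dots> = (\<Sum>i<Suc l. if i = m then blinfun_apply (f m) z else 0)"
        by (intro sum.cong refl) (simp add: biorthogonal)
      also have "\<dots> = blinfun_apply (f m) z" using that by simp
      finally show "blinfun_apply (f m o\<^sub>L P l) z = blinfun_apply (f m) z" .
    qed
    then have "(c *\<^sub>C \<eta> + \<psi>) o\<^sub>L P l = c *\<^sub>C \<eta> + \<psi>" if "l \<ge> max m L" for l
      using that L[of l] unfolding m
      by (auto simp: blinfun_eq_iff blinfun.add_left scaleC_blinfun.rep_eq)
    then show ?case by blast
  qed
  have "(\<lambda>l. \<phi> o\<^sub>L P l) \<longlonglongrightarrow> \<phi>"
  proof (rule LIMSEQ_I)
    fix e :: real assume e: "e > 0"
    \<comment> \<open>the error is at most \<open>d * K + d\<close>; the 2 makes this strictly less than \<open>e\<close>\<close>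
    define d where "d = e / (K + 2)"
    have d: "d > 0" using e K0 by (simp add: d_def)
    obtain \<psi> where \<psi>: "\<psi> \<in> cspan (range f)" "dist \<psi> \<phi> < d"
      using \<phi> d unfolding closure_approachable by blast
    obtain L where L: "\<And>l. l \<ge> L \<Longrightarrow> \<psi> o\<^sub>L P l = \<psi>" using fixed[OF \<psi>(1)] by blast
    have "norm ((\<phi> o\<^sub>L P l) - \<phi>) < e" if "l \<ge> L" for l
    proof -
      have "(\<phi> o\<^sub>L P l) - \<phi> = ((\<phi> - \<psi>) o\<^sub>L P l) + (\<psi> - \<phi>)"
        using L[OF that] by (simp add: blinfun_eq_iff blinfun.diff_left blinfun.add_left)
      then have "norm ((\<phi> o\<^sub>L P l) - \<phi>) \<le> norm ((\<phi> - \<psi>) o\<^sub>L P l) + norm (\<psi> - \<phi>)"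
        by (metis norm_triangle_ineq)
      also have "norm ((\<phi> - \<psi>) o\<^sub>L P l) \<le> norm (\<phi> - \<psi>) * norm (P l)"
        by (rule norm_blinfun_compose)
      also have "\<dots> \<le> d * K"
        using \<psi>(2) K d by (intro mult_mono) (auto simp: dist_norm norm_minus_commute)
      also have "norm (\<psi> - \<phi>) < d" using \<psi>(2) by (simp add: dist_norm)
      also have "d * K + d < e"
      proof -
        have "d * (K + 2) = e" using K0 by (simp add: d_def)
        then have "d * K + 2 * d = e" by (simp add: distrib_left)
        then show ?thesis using d by linarith
      qed
      finally show ?thesis by simp
    qed
    then show "\<exists>L. \<forall>l\<ge>L. norm ((\<phi> o\<^sub>L P l) - \<phi>) < e" by blast
  qed
  then show ?thesis by (simp add: P_def)
qed

end

section \<open>Property A\<close>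

lemma directed_set_nat: "directed_set (UNIV :: nat set) (\<le>)"
  unfolding directed_set_def by (auto intro: max.cobounded1 max.cobounded2)

lemma net_filter_nat: "net_filter (UNIV :: nat set) (\<le>) = sequentially"
  using eventually_net_filter[OF directed_set_nat]
  by (simp add: filter_eq_iff eventually_sequentially)

theorem theorem4p5:
  fixes x :: "nat \<Rightarrow> 'a::complex_banach"
  assumes "schauder_basis x"
    and "subsymmetric_basis x"
    and "shrinking_basis x"
  shows "property_A TYPE('a)"
proof -
  obtain f where f: "\<And>n. f n \<in> cdual" "\<And>n. blinfun_apply (f n) = basis_coord x n"
    and dense: "closure (cspan (range f)) = cdual"
    using assms(3) unfolding shrinking_basis_def by blast
  have ex1: "\<exists>!a. (\<lambda>n. a n *\<^sub>C x n) sums z" for z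
    using assms(1) unfolding schauder_basis_def by blast
  interpret subsymmetric_coordinates x f
  proof
    show "(\<lambda>n. blinfun_apply (f n) z *\<^sub>C x n) sums z" for z
      unfolding f(2) basis_coord_def by (rule theI'[OF ex1])
    show "a n = blinfun_apply (f n) z" if "(\<lambda>n. a n *\<^sub>C x n) sums z" for a z n
    proof -
      have "(THE a. (\<lambda>n. a n *\<^sub>C x n) sums z) = a"
        by (rule the1_equality) (fact ex1, fact that)
      then show ?thesis unfolding f(2) basis_coord_def by simp
    qed
    show "summable (\<lambda>n. blinfun_apply (f (\<pi> n)) z *\<^sub>C x (\<pi> n))" if "bij \<pi>" for \<pi> z
      using assms(2) that unfolding subsymmetric_basis_def unconditional_basis_def f(2) by blast
    show "summable (\<lambda>n. a n *\<^sub>C x n) \<longleftrightarrow> summable (\<lambda>n. a n *\<^sub>C x (s n))" if "strict_mono s" for s a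
      using assms(2) that unfolding subsymmetric_basis_def equivalent_sequences_def comp_def by blast
  qed
  obtain K where K: "\<And>n g. n > 0 \<Longrightarrow> g \<in> signed_shifts n \<Longrightarrow> norm (matrix_operator n x f g) \<le> K"
    using signed_shifts_uniformly_bounded by blast
  have "property_A_witness (UNIV :: nat set) (\<le>) Suc (\<lambda>_. x) (\<lambda>_. f)"
    unfolding property_A_witness_def Let_def net_filter_nat
  proof (intro conjI ballI allI exI[of _ "\<lambda>l. signed_shifts (Suc l)"])
    show "directed_set (UNIV :: nat set) (\<le>)" by (rule directed_set_nat)
    show "biorthogonal_system (Suc l) x f" for l
      using f(1) by (simp add: biorthogonal_system_def biorthogonal)
    show "(\<lambda>l. blinfun_apply (matrix_operator (Suc l) x f (1\<^sub>m (Suc l))) z) \<longlonglongrightarrow> z" for z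
      by (rule projection_tendsto)
    show "(\<lambda>l. \<phi> o\<^sub>L matrix_operator (Suc l) x f (1\<^sub>m (Suc l))) \<longlonglongrightarrow> \<phi>" if "\<phi> \<in> cdual" for \<phi>
      using f(1) that dense by (intro adjoint_projection_tendsto) auto
    show "irreducible_matrix_group (Suc l) (signed_shifts (Suc l))" for l
      by (rule irreducible_signed_shifts) simp
    show "bdd_above {norm (matrix_operator (Suc l) x f g) | l g. l \<in> UNIV \<and> g \<in> signed_shifts (Suc l)}"
      using K by (intro bdd_aboveI[of _ K]) auto
  qed
  then show ?thesis by (rule property_A_if_witness)
qed

end
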